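(* Let $\Sigma=\{0,\dots,k-1\}$, $k\ge2$, and let $\alpha,\beta$ be positive probability measures on $\Sigma$. Then for every $\alpha$-normal sequence $R\in\Sigma^\infty$, \[\dim_{\mathrm{FS}}^\beta(R)=\mathrm{Dim}_{\mathrm{FS}}^\beta(R)=\frac{\mathcal{H}(\alpha)}{\mathcal{H}(\alpha)+\mathcal{D}(\alpha\|\beta)}.\]
   Context: Measures are extended to strings by $\alpha(w)=\prod_i\alpha(w[i])$; $\mu$ is the uniform measure, $\mu(w)=k^{-|w|}$. A finite-state gambler (FSG) is $G=(Q,\delta,q_0,B)$ with $Q$ finite, $\delta:Q\times\Sigma\to Q$, $q_0\in Q$, and $B$ assigning to each state a rational-valued probability measure on $\Sigma$; $\delta(w)$ is the state reached from $q_0$ on $w$. Its martingale is $d_G(\lambda)=1$, $d_G(wa)=k\,d_G(w)B(\delta(w))(a)$, and $d^{(s)}_{G,\beta}(w)=\frac{\mu(w)}{\beta(w)^s}d_G(w)$. $\dim_{\mathrm{FS}}^\beta(S)$ (resp. $\mathrm{Dim}_{\mathrm{FS}}^\beta(S)$) is the infimum of $s\ge0$ such that some FSG $G$ has $\limsup_n d^{(s)}_{G,\beta}(S[0..n-1])=\infty$ (resp. $\liminf_n d^{(s)}_{G,\beta}(S[0..n-1])=\infty$). For nonempty $w$ and $n\ge1$, $\pi_{S,n}(w)$ is $\frac1n$ times the number of $m\in\{0,\dots,n-1\}$ with $S[m|w|..(m+1)|w|-1]=w$. $S$ is $\alpha$-normal if $\lim_{n\to\infty}\pi_{S,n}(w)=\alpha(w)$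 for every nonempty $w\in\Sigma^*$. $\mathcal{H}(\alpha)=\sum_a\alpha(a)\log\frac1{\alpha(a)}$, $\mathcal{D}(\alpha\|\beta)=\sum_a\alpha(a)\log\frac{\alpha(a)}{\beta(a)}$, logs base 2. *)

theory Defs
  imports Complex_Main "HOL-Library.Extended_Real"
begin

text \<open>The alphabet is \<open>{..<k}\<close>, words are lists and infinite sequences are functions on \<open>nat\<close>.
  Measures and transition functions are total functions whose values outside the alphabet
  are irrelevant.\<close>

definition words :: "nat \<Rightarrow> nat list set" where
  "words k = lists {..<k}"

definition sequences :: "nat \<Rightarrow> (nat \<Rightarrow> nat) set" where
  "sequences k = {S. \<forall>i. S i < k}"

definition seq_prefix :: "(nat \<Rightarrow> nat) \<Rightarrow> nat \<Rightarrow> nat list" where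
  "seq_prefix S n = map S [0..<n]"

definition prob_measure_on :: "nat \<Rightarrow> (nat \<Rightarrow> real) \<Rightarrow> bool" where
  "prob_measure_on k \<alpha> \<longleftrightarrow> (\<forall>a<k. 0 \<le> \<alpha> a) \<and> (\<Sum>a<k. \<alpha> a) = 1"

definition positive_prob_measure_on :: "nat \<Rightarrow> (nat \<Rightarrow> real) \<Rightarrow> bool" where
  "positive_prob_measure_on k \<alpha> \<longleftrightarrow> prob_measure_on k \<alpha> \<and> (\<forall>a<k. 0 < \<alpha> a)"

definition word_measure :: "(nat \<Rightarrow> real) \<Rightarrow> nat list \<Rightarrow> real" where
  "word_measure \<alpha> w = (\<Prod>i<length w. \<alpha> (w ! i))"

definition uniform_measure :: "nat \<Rightarrow> nat \<Rightarrow> real" where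
  "uniform_measure k a = 1 / real k"

lemma word_measure_uniform: "word_measure (uniform_measure k) w = (1 / real k) ^ length w"
  by (simp add: word_measure_def uniform_measure_def)

record 'q gambler =
  states :: "'q set"
  step :: "'q \<Rightarrow> nat \<Rightarrow> 'q"
  start :: 'q
  bet :: "'q \<Rightarrow> nat \<Rightarrow> real"

definition FSG :: "nat \<Rightarrow> 'q gambler \<Rightarrow> bool" where
  "FSG k G \<longleftrightarrow>
     finite (states G) \<and>
     start G \<in> states G \<and>
     (\<forall>q\<in>states G. \<forall>a<k. step G q a \<in> states G) \<and>
     (\<forall>q\<in>states G. prob_measure_on k (bet G q) \<and> (\<forall>a<k. bet G q a \<in> \<rat>))"

definition state_after :: "'q gambler \<Rightarrow> nat list \<Rightarrow> 'q" where
  "state_after G w = foldl (step G) (start G) w"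

fun martingale :: "nat \<Rightarrow> 'q gambler \<Rightarrow> nat list \<Rightarrow> real" where
  "martingale k G w =
     (if w = [] then 1
      else real k * martingale k G (butlast w) * bet G (state_after G (butlast w)) (last w))"

declare martingale.simps [simp del]

lemma martingale_Nil [simp]: "martingale k G [] = 1"
  by (simp add: martingale.simps)

lemma martingale_snoc [simp]:
  "martingale k G (w @ [a]) = real k * martingale k G w * bet G (state_after G w) a"
  by (simp add: martingale.simps[of k G "w @ [a]"])

definition gale :: "nat \<Rightarrow> (nat \<Rightarrow> real) \<Rightarrow> real \<Rightarrow> 'q gambler \<Rightarrow> nat list \<Rightarrow> real" where
  "gale k \<beta> s G w =
     word_measure (uniform_measure k) w / word_measure \<beta> w powr s * martingale k G w"

text \<open>Since state sets are finite, it loses no generality to let gamblers have states in \<open>nat\<close>.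
  The infima are taken in the extended reals, so the infimum of the empty set is \<open>\<infinity>\<close>.\<close>

definition dim_FS :: "nat \<Rightarrow> (nat \<Rightarrow> real) \<Rightarrow> (nat \<Rightarrow> nat) \<Rightarrow> ereal" where
  "dim_FS k \<beta> S =
     Inf (ereal ` {s. 0 \<le> s \<and> (\<exists>G :: nat gambler. FSG k G \<and>
       limsup (\<lambda>n. ereal (gale k \<beta> s G (seq_prefix S n))) = \<infinity>)})"

definition Dim_FS :: "nat \<Rightarrow> (nat \<Rightarrow> real) \<Rightarrow> (nat \<Rightarrow> nat) \<Rightarrow> ereal" where
  "Dim_FS k \<beta> S =
     Inf (ereal ` {s. 0 \<le> s \<and> (\<exists>G :: nat gambler. FSG k G \<and>
       liminf (\<lambda>n. ereal (gale k \<beta> s G (seq_prefix S n))) = \<infinity>)})"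

definition block_frequency :: "(nat \<Rightarrow> nat) \<Rightarrow> nat \<Rightarrow> nat list \<Rightarrow> real" where
  "block_frequency S n w =
     real (card {m. m < n \<and> map S [m * length w..<(m + 1) * length w] = w}) / real n"

definition seq_normal :: "nat \<Rightarrow> (nat \<Rightarrow> real) \<Rightarrow> (nat \<Rightarrow> nat) \<Rightarrow> bool" where
  "seq_normal k \<alpha> S \<longleftrightarrow>
     (\<forall>w\<in>words k. w \<noteq> [] \<longrightarrow> (\<lambda>n. block_frequency S n w) \<longlonglongrightarrow> word_measure \<alpha> w)"

definition shannon_entropy :: "nat \<Rightarrow> (nat \<Rightarrow> real) \<Rightarrow> real" where
  "shannon_entropy k \<alpha> = (\<Sum>a<k. \<alpha> a * log 2 (1 / \<alpha> a))"

definition kl_divergence :: "nat \<Rightarrow> (nat \<Rightarrow> real) \<Rightarrow> (nat \<Rightarrow> real) \<Rightarrow> real" where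
  "kl_divergence k \<alpha> \<beta> = (\<Sum>a<k. \<alpha> a * log 2 (\<alpha> a / \<beta> a))"

end

theory Submission imports Defs begin

text \<open>The factors \<open>k\<close> cancel, so the gale of a gambler is the product of its bets divided by
  \<open>\<beta>(w)\<^sup>s\<close>.  A one-state gambler whose rational bet is close to \<open>\<alpha>\<close> attains every exponent above
  the claimed value, by the law of single-letter frequencies.  Conversely, cut \<open>R\<close> into
  blocks of length \<open>l\<close>.  From each state the bets along a block form a probability measure on
  words of length \<open>l\<close>; bound the bets on a block by the sum \<open>P\<close> of these measures over all states.
  By \<open>ln y \<le> y - 1\<close> applied to \<open>y = P(w) / (|Q| \<alpha>(w))\<close> and by the block frequencies, the gambler beats
  \<open>\<alpha>\<close> by at most a factor \<open>|Q|\<close> per block on average, which is negligible as \<open>l\<close> grows.\<close>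

section \<open>Bets along words as measures on blocks\<close>

definition blocks :: "nat \<Rightarrow> nat \<Rightarrow> nat list set" where
  "blocks k l = {w. set w \<subseteq> {..<k} \<and> length w = l}"

text \<open>This is the martingale with its factors \<open>k\<close> removed, started from an
  arbitrary state so that it can be restarted at block boundaries.\<close>

fun bet_weight :: "'q gambler \<Rightarrow> 'q \<Rightarrow> nat list \<Rightarrow> real" where
  "bet_weight G q [] = 1"
| "bet_weight G q (a # w) = bet G q a * bet_weight G (step G q a) w"

text \<open>It serves twice: with rational \<open>p\<close> as the winning strategy, and with any
  \<open>p\<close> as a device that makes product measures a special case of
  \<open>bet_weight\<close>.\<close>

definition iid_gambler :: "(nat \<Rightarrow> real) \<Rightarrow> nat gambler" where
  "iid_gambler p = \<lparr>states = {0}, step = (\<lambda>_ _. 0), start = 0, bet = (\<lambda>_. p)\<rparr>"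

lemma finite_blocks [simp]: "finite (blocks k l)"
  by (simp add: blocks_def finite_lists_length_eq)

lemma sum_blocks_Suc:
  "(\<Sum>w\<in>blocks k (Suc l). f w) = (\<Sum>a<k. \<Sum>w\<in>blocks k l. f (a # w))"
proof -
  have "blocks k (Suc l) = (\<lambda>(a, w). a # w) ` ({..<k} \<times> blocks k l)"
    by (auto simp: blocks_def length_Suc_conv image_iff)
  moreover have "inj_on (\<lambda>(a, w). a # w) ({..<k} \<times> blocks k l)"
    by (auto simp: inj_on_def)
  ultimately show ?thesis
    by (simp add: sum.reindex sum.cartesian_product case_prod_unfold)
qed

lemma bet_weight_append:
  "bet_weight G q (u @ v) = bet_weight G q u * bet_weight G (foldl (step G) q u) v"
  by (induction u arbitrary: q) auto

text \<open>The martingale recurses on the last letter and \<open>bet_weight\<close> on the first;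
  \<open>bet_weight_append\<close> reconciles the two under reverse induction.\<close>

lemma martingale_eq_bet_weight:
  "martingale k G w = real k ^ length w * bet_weight G (start G) w"
  by (induction w rule: rev_induct) (auto simp: bet_weight_append state_after_def)

lemma sum_bet_weight_blocks:
  assumes "\<And>q a. q \<in> Q \<Longrightarrow> a < k \<Longrightarrow> step G q a \<in> Q"
    and "\<And>q. q \<in> Q \<Longrightarrow> (\<Sum>a<k. bet G q a) = 1"
    and "q \<in> Q"
  shows "(\<Sum>w\<in>blocks k l. bet_weight G q w) = 1"
  using assms(3)
proof (induction l arbitrary: q)
  case 0
  have "blocks k 0 = {[]}" by (auto simp: blocks_def)
  then show ?case by simp
next
  case (Suc l)
  then show ?case
    by (simp add: sum_blocks_Suc assms flip: sum_distrib_left)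
qed

lemma word_measure_prod_list: "word_measure p w = prod_list (map p w)"
proof (induction w)
  case (Cons a w)
  then show ?case by (simp add: word_measure_def prod.lessThan_Suc_shift del: prod.lessThan_Suc)
qed (simp add: word_measure_def)

lemma word_measure_append: "word_measure p (u @ v) = word_measure p u * word_measure p v"
  by (simp add: word_measure_prod_list)

lemma word_measure_eq_bet_weight: "word_measure p w = bet_weight (iid_gambler p) 0 w"
  by (induction w) (auto simp: word_measure_prod_list iid_gambler_def)

lemma sum_word_measure_blocks:
  assumes "prob_measure_on k p"
  shows "(\<Sum>w\<in>blocks k l. word_measure p w) = 1"
  unfolding word_measure_eq_bet_weight
  using assms by (intro sum_bet_weight_blocks[where Q = "{0}"])
    (auto simp: iid_gambler_def prob_measure_on_def)

lemma word_measure_pos: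
  assumes "\<And>a. a < k \<Longrightarrow> 0 < p a" "set w \<subseteq> {..<k}"
  shows "0 < word_measure p w"
  using assms(2) by (induction w) (auto simp: word_measure_prod_list assms(1))

lemma gale_eq_bet_weight:
  assumes "0 < k"
  shows "gale k \<beta> s G w = bet_weight G (start G) w / word_measure \<beta> w powr s"
  using assms
  by (simp add: gale_def word_measure_uniform martingale_eq_bet_weight power_one_over)

lemma seq_prefix_append_block:
  "seq_prefix S (Suc N * l) = seq_prefix S (N * l) @ map S [N * l..<(N + 1) * l]"
  using upt_add_eq_append[of 0 "N * l" l] by (simp add: seq_prefix_def add.commute)

lemma set_map_seq: "S \<in> sequences k \<Longrightarrow> set (map S xs) \<subseteq> {..<k}"
  by (auto simp: sequences_def)

lemma set_seq_prefix: "S \<in> sequences k \<Longrightarrow> set (seq_prefix S n) \<subseteq> {..<k}"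
  unfolding seq_prefix_def by (rule set_map_seq)

lemma word_measure_seq_prefix: "word_measure p (seq_prefix S n) = (\<Prod>i<n. p (S i))"
  by (simp add: word_measure_def seq_prefix_def)

section \<open>Averages along normal sequences\<close>

text \<open>Grouping the times \<open>m\<close> by the value \<open>b m\<close> turns the average
  into a finite combination of frequencies. It is applied with \<open>b m\<close> a block and with
  \<open>b m\<close> a single letter.\<close>

lemma average_tendsto:
  fixes f :: "'a \<Rightarrow> real"
  assumes "finite W" "\<And>m. b m \<in> W"
    and "\<And>w. w \<in> W \<Longrightarrow> (\<lambda>n. real (card {m. m < n \<and> b m = w}) / real n) \<longlonglongrightarrow> p w"
  shows "(\<lambda>n. (\<Sum>m<n. f (b m)) / real n) \<longlonglongrightarrow> (\<Sum>w\<in>W. p w * f w)"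
proof -
  have "(\<Sum>m<n. f (b m)) = (\<Sum>w\<in>W. real (card {m. m < n \<and> b m = w}) * f w)" for n
  proof -
    have "(\<Sum>m<n. f (b m)) = (\<Sum>w\<in>W. \<Sum>m\<in>{m\<in>{..<n}. b m = w}. f (b m))"
      using assms(1,2) by (intro sum.group[symmetric]) auto
    also have "\<dots> = (\<Sum>w\<in>W. real (card {m. m < n \<and> b m = w}) * f w)"
      by (intro sum.cong) auto
    finally show ?thesis .
  qed
  then have eq: "(\<lambda>n. (\<Sum>m<n. f (b m)) / real n) =
      (\<lambda>n. \<Sum>w\<in>W. real (card {m. m < n \<and> b m = w}) / real n * f w)"
    by (simp add: sum_divide_distrib)
  show ?thesis
    unfolding eq by (intro tendsto_intros assms(3))
qed

lemma normal_block_average: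
  assumes "seq_normal k \<alpha> R" "R \<in> sequences k" "0 < l"
  shows "(\<lambda>n. (\<Sum>m<n. f (map R [m * l..<(m + 1) * l])) / real n)
    \<longlonglongrightarrow> (\<Sum>w\<in>blocks k l. word_measure \<alpha> w * f w)"
proof (rule average_tendsto)
  show "map R [m * l..<(m + 1) * l] \<in> blocks k l" for m
    using assms(2) by (auto simp: blocks_def sequences_def)
next
  fix w assume w: "w \<in> blocks k l"
  then have "w \<in> words k" "w \<noteq> []" "length w = l"
    using assms(3) by (auto simp: blocks_def words_def)
  then show "(\<lambda>n. real (card {m. m < n \<and> map R [m * l..<(m + 1) * l] = w}) / real n)
      \<longlonglongrightarrow> word_measure \<alpha> w"
    using assms(1) unfolding seq_normal_def block_frequency_def by blast
qed simp

lemma normal_letter_average: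
  assumes "seq_normal k \<alpha> R" "R \<in> sequences k"
  shows "(\<lambda>n. (\<Sum>i<n. f (R i)) / real n) \<longlonglongrightarrow> (\<Sum>a<k. \<alpha> a * f a)"
proof (rule average_tendsto)
  show "R m \<in> {..<k}" for m
    using assms(2) by (auto simp: sequences_def)
next
  fix a assume a: "a \<in> {..<k}"
  then have "(\<lambda>n. block_frequency R n [a]) \<longlonglongrightarrow> word_measure \<alpha> [a]"
    using assms(1) unfolding seq_normal_def words_def by auto
  then show "(\<lambda>n. real (card {m. m < n \<and> R m = a}) / real n) \<longlonglongrightarrow> \<alpha> a"
    by (simp add: block_frequency_def word_measure_def)
qed simp

section \<open>Upper bound: betting almost according to \<alpha>\<close>

text \<open>Rounding down all letters but \<open>0\<close> and giving the excess to the letter \<open>0\<close>.\<close>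
lemma rational_measure_below:
  fixes \<alpha> :: "nat \<Rightarrow> real"
  assumes "positive_prob_measure_on k \<alpha>" "0 < k" "c < 1"
  obtains r where "prob_measure_on k r" "\<forall>a<k. r a \<in> \<rat>" "\<forall>a<k. c * \<alpha> a < r a"
proof -
  have pos: "0 < \<alpha> a" if "a < k" for a
    using assms(1) that by (auto simp: positive_prob_measure_on_def)
  have sum1: "(\<Sum>a<k. \<alpha> a) = 1"
    using assms(1) by (auto simp: positive_prob_measure_on_def prob_measure_on_def)
  \<comment> \<open>\<open>c\<close> may be negative, so the maximum with \<open>0\<close> is what
    keeps the rounded values positive.\<close>
  have "\<exists>x\<in>\<rat>. max 0 (c * \<alpha> a) < x \<and> x < \<alpha> a" if "a < k" for a
    using pos[OF that] assms(3) by (intro Rats_dense_in_real) auto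
  then obtain t where t: "\<And>a. a < k \<Longrightarrow> t a \<in> \<rat> \<and> max 0 (c * \<alpha> a) < t a \<and> t a < \<alpha> a"
    by metis
  define r where "r a = (if a = 0 then 1 - (\<Sum>b\<in>{1..<k}. t b) else t a)" for a
  have split: "(\<Sum>a<k. g a) = g 0 + (\<Sum>a\<in>{1..<k}. g a)" for g :: "nat \<Rightarrow> real"
    using assms(2) by (simp add: lessThan_atLeast0 sum.atLeast_Suc_lessThan)
  have "(\<Sum>b\<in>{1..<k}. t b) \<le> (\<Sum>b\<in>{1..<k}. \<alpha> b)"
    by (intro sum_mono) (use t in \<open>auto intro: less_imp_le\<close>)
  then have r0: "\<alpha> 0 \<le> r 0"
    using sum1 by (simp add: r_def split[of \<alpha>])
  have below: "max 0 (c * \<alpha> a) < r a" if "a < k" for a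
  proof (cases "a = 0")
    case True
    then show ?thesis using t[OF that] r0 by simp
  next
    case False
    then show ?thesis using t[OF that] by (simp add: r_def)
  qed
  show ?thesis
  proof
    have "(\<Sum>a<k. r a) = 1" by (simp add: split r_def)
    then show "prob_measure_on k r"
      using below by (auto simp: prob_measure_on_def intro: less_imp_le)
    have "(\<Sum>b\<in>{1..<k}. t b) \<in> \<rat>" using t by (intro Rats_sum) auto
    then show "\<forall>a<k. r a \<in> \<rat>" using t by (auto simp: r_def)
    show "\<forall>a<k. c * \<alpha> a < r a" using below by auto
  qed
qed

lemma average_limit_pos_at_top:
  assumes "(\<lambda>n. X n / real n) \<longlonglongrightarrow> c" "0 < c"
  shows "filterlim X at_top sequentially"
proof -
  have "filterlim (\<lambda>n. X n / real n * real n) at_top sequentially"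
    using assms by (rule filterlim_tendsto_pos_mult_at_top) (rule filterlim_real_sequentially)
  \<comment> \<open>Division by \<open>0\<close> yields \<open>0\<close>, so the cancellation is
    claimed only for positive \<open>n\<close>.\<close>
  moreover have "\<forall>\<^sub>F n in sequentially. X n / real n * real n = X n"
    using eventually_gt_at_top[of 0] by eventually_elim simp
  ultimately show ?thesis
    using filterlim_cong by force
qed

text \<open>For the gambler betting a fixed measure \<open>r\<close>, the logarithm of the gale is a
  sum of a function of single letters. Normality gives its mean per letter, which stays positive
  when \<open>r\<close> is close enough to \<alpha>, so the gale tends to infinity.\<close>

lemma liminf_gale_eq_infinity:
  assumes k: "0 < k" and \<alpha>: "positive_prob_measure_on k \<alpha>" and \<beta>: "positive_prob_measure_on k \<beta>"
    and R: "R \<in> sequences k" "seq_normal k \<alpha> R"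
    and s: "0 < (\<Sum>a<k. \<alpha> a * ln (\<alpha> a)) - s * (\<Sum>a<k. \<alpha> a * ln (\<beta> a))"
  obtains G :: "nat gambler" where "FSG k G"
    "liminf (\<lambda>n. ereal (gale k \<beta> s G (seq_prefix R n))) = \<infinity>"
proof -
  define e where "e = (\<Sum>a<k. \<alpha> a * ln (\<alpha> a)) - s * (\<Sum>a<k. \<alpha> a * ln (\<beta> a))"
  have e: "0 < e" using s by (simp add: e_def)
  have apos: "0 < \<alpha> a" and bpos: "0 < \<beta> a" if "a < k" for a
    using \<alpha> \<beta> that by (auto simp: positive_prob_measure_on_def)
  have sum1: "(\<Sum>a<k. \<alpha> a) = 1"
    using \<alpha> by (auto simp: positive_prob_measure_on_def prob_measure_on_def)
  \<comment> \<open>The factor \<open>exp (- e / 2)\<close> limits the logarithmic loss from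
    rounding to \<open>e / 2\<close> per letter, which leaves a mean gain of at least
    \<open>e / 2\<close>.\<close>
  obtain r where r: "prob_measure_on k r" "\<forall>a<k. r a \<in> \<rat>" "\<forall>a<k. exp (- e / 2) * \<alpha> a < r a"
    using rational_measure_below[OF \<alpha> k, of "exp (- e / 2)"] e by auto
  have rpos: "0 < r a" if "a < k" for a
    using r(3) that apos[OF that] by (meson exp_gt_zero less_trans mult_pos_pos)
  define G where "G = iid_gambler r"
  define X where "X n = (\<Sum>i<n. ln (r (R i)) - s * ln (\<beta> (R i)))" for n
  have Rk: "R i < k" for i using R(1) by (simp add: sequences_def)
  have "gale k \<beta> s G (seq_prefix R n) = exp (X n)" for n
  proof -
    have "gale k \<beta> s G (seq_prefix R n) =
        (\<Prod>i<n. r (R i)) / (\<Prod>i<n. \<beta> (R i)) powr s"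
      by (simp add: gale_eq_bet_weight[OF k] G_def word_measure_seq_prefix iid_gambler_def
          flip: word_measure_eq_bet_weight[unfolded iid_gambler_def])
    also have "\<dots> = (\<Prod>i<n. r (R i) / \<beta> (R i) powr s)"
      by (simp add: prod_dividef prod_powr_distrib bpos less_imp_le Rk)
    also have "\<dots> = exp (X n)"
      unfolding X_def using rpos[OF Rk] bpos[OF Rk]
      by (simp add: exp_sum exp_diff powr_def less_imp_neq[symmetric])
    finally show ?thesis .
  qed
  moreover have "filterlim X at_top sequentially"
  proof (rule average_limit_pos_at_top)
    show "(\<lambda>n. X n / real n) \<longlonglongrightarrow> (\<Sum>a<k. \<alpha> a * (ln (r a) - s * ln (\<beta> a)))"
      unfolding X_def using normal_letter_average[OF R(2,1)] .
    have "(\<Sum>a<k. \<alpha> a * (ln (\<alpha> a) - e / 2)) \<le> (\<Sum>a<k. \<alpha> a * ln (r a))"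
    proof (intro sum_mono mult_left_mono)
      fix a assume a: "a \<in> {..<k}"
      have "ln (exp (- e / 2) * \<alpha> a) \<le> ln (r a)"
        using r(3) a apos[of a] by (intro ln_mono) (auto intro: less_imp_le)
      then show "ln (\<alpha> a) - e / 2 \<le> ln (r a)"
        using apos[of a] a by (simp add: ln_mult)
    qed (use apos in \<open>auto intro: less_imp_le\<close>)
    then have "(\<Sum>a<k. \<alpha> a * ln (\<alpha> a)) - e / 2 \<le> (\<Sum>a<k. \<alpha> a * ln (r a))"
      using sum1 by (simp add: right_diff_distrib sum_subtractf flip: sum_distrib_right sum_divide_distrib)
    moreover have "(\<Sum>a<k. \<alpha> a * (ln (r a) - s * ln (\<beta> a))) =
        (\<Sum>a<k. \<alpha> a * ln (r a)) - s * (\<Sum>a<k. \<alpha> a * ln (\<beta> a))"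
      by (simp add: right_diff_distrib sum_subtractf sum_distrib_left mult_ac)
    ultimately show "0 < (\<Sum>a<k. \<alpha> a * (ln (r a) - s * ln (\<beta> a)))"
      using e e_def by argo
  qed
  ultimately have "filterlim (\<lambda>n. gale k \<beta> s G (seq_prefix R n)) at_top sequentially"
    by (simp add: filterlim_compose[OF exp_at_top])
  then have "liminf (\<lambda>n. ereal (gale k \<beta> s G (seq_prefix R n))) = \<infinity>"
    by (intro lim_imp_Liminf) (auto simp: tendsto_PInfty_eq_at_top)
  moreover have "FSG k G"
    using r(1,2) by (auto simp: FSG_def G_def iid_gambler_def)
  ultimately show ?thesis using that by blast
qed

section \<open>Lower bound: the gain of an arbitrary gambler\<close>

text \<open>Nonnegativity lets one state be bounded by the sum over all states; the bound
  \<open>1\<close> later discards an incomplete final block.\<close>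

lemma bet_weight_bounds:
  assumes "FSG k G" "q \<in> states G" "set w \<subseteq> {..<k}"
  shows "0 \<le> bet_weight G q w" "bet_weight G q w \<le> 1"
proof -
  have "0 \<le> bet_weight G q w \<and> bet_weight G q w \<le> 1"
    using assms(2,3)
  proof (induction w arbitrary: q)
    case (Cons a w)
    then have *: "a < k" "step G q a \<in> states G" "prob_measure_on k (bet G q)"
      using assms(1) by (auto simp: FSG_def)
    then have "bet G q a \<le> (\<Sum>b<k. bet G q b)"
      by (intro member_le_sum) (auto simp: prob_measure_on_def)
    with * have "0 \<le> bet G q a" "bet G q a \<le> 1"
      by (auto simp: prob_measure_on_def)
    with Cons * show ?case by (auto intro: mult_le_one)
  qed simp
  then show "0 \<le> bet_weight G q w" "bet_weight G q w \<le> 1" by auto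
qed

lemma foldl_step_in_states:
  assumes "FSG k G" "q \<in> states G" "set w \<subseteq> {..<k}"
  shows "foldl (step G) q w \<in> states G"
  using assms(2,3)
proof (induction w arbitrary: q)
  case (Cons a w)
  then show ?case using assms(1) by (auto simp: FSG_def)
qed simp

text \<open>The logarithmic gain over \<open>\<alpha>\<close> on the block \<open>w\<close> from any state, in the form given by \<open>ln y \<le> y - 1\<close>.
  Unlike a logarithm of the bets it stays meaningful when bets vanish.\<close>
definition block_gain :: "(nat \<Rightarrow> real) \<Rightarrow> 'q gambler \<Rightarrow> nat list \<Rightarrow> real" where
  "block_gain \<alpha> G w =
    (\<Sum>q\<in>states G. bet_weight G q w) / (card (states G) * word_measure \<alpha> w) - 1
    + ln (card (states G))"

lemma card_states_pos: "FSG k G \<Longrightarrow> 0 < card (states G)"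
  by (auto simp: FSG_def card_gt_0_iff)

text \<open>With \<open>P\<close> the sum over all states, \<open>c\<close> their number and
  \<open>y = P / (c * word_measure \<alpha> w)\<close>, this is \<open>y \<le> exp (y - 1)\<close>.
  The right side does not depend on \<open>q\<close>: normality controls how often a block occurs,
  but says nothing directly about the state in which it is entered.\<close>

lemma bet_weight_le_block_gain:
  assumes "FSG k G" "q \<in> states G" "set w \<subseteq> {..<k}" "\<And>a. a < k \<Longrightarrow> 0 < \<alpha> a"
  shows "bet_weight G q w \<le> word_measure \<alpha> w * exp (block_gain \<alpha> G w)"
proof -
  define P where "P = (\<Sum>q\<in>states G. bet_weight G q w)"
  define c where "c = real (card (states G))"
  have c: "0 < c" using card_states_pos[OF assms(1)] by (simp add: c_def)
  have \<alpha>: "0 < word_measure \<alpha> w" using assms(3,4) word_measure_pos by blast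
  have "bet_weight G q w \<le> P"
    unfolding P_def using assms(1,2) bet_weight_bounds(1)[OF assms(1) _ assms(3)]
    by (intro member_le_sum) (auto simp: FSG_def)
  also have "P = word_measure \<alpha> w * (P / (c * word_measure \<alpha> w) * c)"
    using c \<alpha> by simp
  also have "\<dots> \<le> word_measure \<alpha> w * (exp (P / (c * word_measure \<alpha> w) - 1) * c)"
    using exp_ge_add_one_self[of "P / (c * word_measure \<alpha> w) - 1"] c \<alpha>
    by (intro mult_left_mono mult_right_mono) auto
  also have "exp (P / (c * word_measure \<alpha> w) - 1) * c = exp (block_gain \<alpha> G w)"
    unfolding block_gain_def P_def[symmetric] c_def[symmetric] using c by (simp add: exp_add)
  finally show ?thesis .
qed

lemma bet_weight_prefix_le:
  assumes G: "FSG k G" and R: "R \<in> sequences k" and \<alpha>: "\<And>a. a < k \<Longrightarrow> 0 < \<alpha> a"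
  shows "bet_weight G (start G) (seq_prefix R (N * l)) \<le>
    word_measure \<alpha> (seq_prefix R (N * l)) *
    exp (\<Sum>m<N. block_gain \<alpha> G (map R [m * l..<(m + 1) * l]))"
proof (induction N)
  case 0
  then show ?case by (simp add: seq_prefix_def word_measure_def)
next
  case (Suc N)
  let ?u = "seq_prefix R (N * l)" and ?v = "map R [N * l..<(N + 1) * l]"
  let ?q = "foldl (step G) (start G) ?u"
  have st: "start G \<in> states G" using G by (simp add: FSG_def)
  then have q: "?q \<in> states G"
    using foldl_step_in_states[OF G] set_seq_prefix[OF R] by blast
  have "bet_weight G (start G) (?u @ ?v) = bet_weight G (start G) ?u * bet_weight G ?q ?v"
    by (rule bet_weight_append)
  also have "\<dots> \<le> (word_measure \<alpha> ?u * exp (\<Sum>m<N. block_gain \<alpha> G (map R [m * l..<(m + 1) * l])))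
      * (word_measure \<alpha> ?v * exp (block_gain \<alpha> G ?v))"
    using Suc bet_weight_le_block_gain[OF G q set_map_seq[OF R] \<alpha>]
      bet_weight_bounds(1)[OF G q set_map_seq[OF R]]
      word_measure_pos[OF \<alpha> set_seq_prefix[OF R]]
    by (intro mult_mono) (auto intro!: mult_nonneg_nonneg less_imp_le)
  also have "\<dots> = word_measure \<alpha> (?u @ ?v) *
      exp (\<Sum>m<Suc N. block_gain \<alpha> G (map R [m * l..<(m + 1) * l]))"
    by (simp add: word_measure_append exp_add mult_ac)
  finally show ?case unfolding seq_prefix_append_block .
qed

text \<open>The weights \<open>word_measure \<alpha> w\<close> cancel and every state contributes
  total bet \<open>1\<close>, so the quotient in \<open>block_gain\<close> has mean
  \<open>1\<close>, which the \<open>- 1\<close> removes. The key point is that the result does not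
  grow with \<open>l\<close>.\<close>

lemma expected_block_gain:
  assumes G: "FSG k G" and \<alpha>: "positive_prob_measure_on k \<alpha>"
  shows "(\<Sum>w\<in>blocks k l. word_measure \<alpha> w * block_gain \<alpha> G w) = ln (card (states G))"
proof -
  define c where "c = real (card (states G))"
  have c: "0 < c" using card_states_pos[OF G] by (simp add: c_def)
  have sum1: "(\<Sum>w\<in>blocks k l. word_measure \<alpha> w) = 1"
    using \<alpha> by (intro sum_word_measure_blocks) (simp add: positive_prob_measure_on_def)
  have "(\<Sum>w\<in>blocks k l. word_measure \<alpha> w * block_gain \<alpha> G w) =
      (\<Sum>w\<in>blocks k l. (\<Sum>q\<in>states G. bet_weight G q w) / c + word_measure \<alpha> w * (ln c - 1))"
  proof (rule sum.cong)
    fix w assume "w \<in> blocks k l"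
    then have "0 < word_measure \<alpha> w"
      using \<alpha> by (intro word_measure_pos[of k]) (auto simp: blocks_def positive_prob_measure_on_def)
    then show "word_measure \<alpha> w * block_gain \<alpha> G w =
        (\<Sum>q\<in>states G. bet_weight G q w) / c + word_measure \<alpha> w * (ln c - 1)"
      using c by (simp add: block_gain_def flip: c_def) (simp add: field_simps)
  qed simp
  also have "\<dots> = (\<Sum>w\<in>blocks k l. \<Sum>q\<in>states G. bet_weight G q w) / c + (ln c - 1)"
    by (simp add: sum.distrib sum1 flip: sum_divide_distrib sum_distrib_right)
  also have "(\<Sum>w\<in>blocks k l. \<Sum>q\<in>states G. bet_weight G q w) =
      (\<Sum>q\<in>states G. \<Sum>w\<in>blocks k l. bet_weight G q w)"
    by (rule sum.swap)
  also have "\<dots> = (\<Sum>q\<in>states G. 1)"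
    using G by (intro sum.cong sum_bet_weight_blocks[where Q = "states G"])
      (auto simp: FSG_def prob_measure_on_def)
  finally show ?thesis using c by (simp add: c_def)
qed

text \<open>At block boundaries the logarithm of the gale is at most \<open>X + Y\<close>, where
  \<open>X\<close> compares \<alpha> with \<open>\<beta> powr s\<close> and \<open>Y\<close> is the
  total block gain. Per block these average to \<open>l * e\<close> and the logarithm of the number
  of states, and a large \<open>l\<close> makes the negative first term win.\<close>

lemma limsup_gale_less_infinity:
  assumes k: "0 < k" and \<alpha>: "positive_prob_measure_on k \<alpha>" and \<beta>: "positive_prob_measure_on k \<beta>"
    and R: "R \<in> sequences k" "seq_normal k \<alpha> R" and s: "0 \<le> s"
    and neg: "(\<Sum>a<k. \<alpha> a * ln (\<alpha> a)) - s * (\<Sum>a<k. \<alpha> a * ln (\<beta> a)) < 0"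
    and G: "FSG k G"
  shows "limsup (\<lambda>n. ereal (gale k \<beta> s G (seq_prefix R n))) < \<infinity>"
proof -
  define e where "e = (\<Sum>a<k. \<alpha> a * ln (\<alpha> a)) - s * (\<Sum>a<k. \<alpha> a * ln (\<beta> a))"
  have apos: "0 < \<alpha> a" and bpos: "0 < \<beta> a" if "a < k" for a
    using \<alpha> \<beta> that by (auto simp: positive_prob_measure_on_def)
  have Rk: "R i < k" for i using R(1) by (simp add: sequences_def)
  \<comment> \<open>Here \<open>e < 0\<close>, and \<open>l\<close> is taken so large that the loss
    \<open>l * (- e)\<close> per block exceeds the gain \<open>ln (card (states G))\<close>. As that
    logarithm is nonnegative, \<open>l\<close> cannot be \<open>0\<close>.\<close>
  obtain l :: nat where "ln (card (states G)) / (- e) < real l"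
    using reals_Archimedean2 by blast
  then have "ln (card (states G)) < real l * - e"
    using neg by (simp add: e_def pos_divide_less_eq)
  moreover have "0 \<le> ln (real (card (states G)))"
    using card_states_pos[OF G] by (intro ln_ge_zero) simp
  ultimately have l: "0 < l" "real l * e + ln (card (states G)) < 0"
    by (auto intro: Nat.gr0I)

  define X where "X n = (\<Sum>i<n. ln (\<alpha> (R i)) - s * ln (\<beta> (R i)))" for n
  define Y where "Y N = (\<Sum>m<N. block_gain \<alpha> G (map R [m * l..<(m + 1) * l]))" for N
  have "(\<lambda>n. X n / real n) \<longlonglongrightarrow> (\<Sum>a<k. \<alpha> a * (ln (\<alpha> a) - s * ln (\<beta> a)))"
    unfolding X_def using normal_letter_average[OF R(2,1)] .
  also have "(\<Sum>a<k. \<alpha> a * (ln (\<alpha> a) - s * ln (\<beta> a))) = e"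
    by (simp add: e_def right_diff_distrib sum_subtractf sum_distrib_left mult_ac)
  \<comment> \<open>Passing to the lengths \<open>N * l\<close> aligns the letter averages with the
    block averages.\<close>
  finally have "(\<lambda>N. X (N * l) / real (N * l)) \<longlonglongrightarrow> e"
    using LIMSEQ_subseq_LIMSEQ[where f = "\<lambda>N. N * l"] l(1)
    by (fastforce simp: strict_mono_def comp_def)
  then have "(\<lambda>N. real l * (X (N * l) / real (N * l)) + Y N / real N)
      \<longlonglongrightarrow> real l * e + ln (card (states G))"
    unfolding Y_def using normal_block_average[OF R(2,1) l(1), of "block_gain \<alpha> G"]
    by (intro tendsto_intros) (simp_all only: expected_block_gain[OF G \<alpha>])
  then have "\<forall>\<^sub>F N in sequentially. real l * (X (N * l) / real (N * l)) + Y N / real N < 0"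
    using l(2) by (rule order_tendstoD(2))
  moreover have "\<forall>\<^sub>F N::nat in sequentially. 0 < N" by (rule eventually_gt_at_top)
  ultimately have "\<forall>\<^sub>F N in sequentially. X (N * l) + Y N \<le> 0"
  proof eventually_elim
    case (elim N)
    then have "(X (N * l) + Y N) / real N < 0"
      using l(1) by (simp add: add_divide_distrib)
    then show ?case using elim by (simp add: divide_less_0_iff)
  qed
  then obtain N0 where N0: "\<And>N. N0 \<le> N \<Longrightarrow> X (N * l) + Y N \<le> 0"
    by (auto simp: eventually_sequentially)

  \<comment> \<open>An incomplete final block has length at most \<open>l\<close>, hence
    \<beta>-measure at least \<open>c ^ l\<close>, since \<open>c \<le> 1\<close>. Its bets are at
    most \<open>1\<close>, so it multiplies the gale by at most \<open>K\<close>.\<close>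
  define c where "c = Min (\<beta> ` {..<k})"
  have c0: "0 < c" using k bpos by (subst c_def, subst Min_gr_iff) auto
  have c_le: "c \<le> \<beta> a" if "a < k" for a using that by (auto simp: c_def)
  have "c \<le> 1"
    using c_le[of 0] k \<beta> member_le_sum[of 0 "{..<k}" \<beta>]
    by (auto simp: positive_prob_measure_on_def prob_measure_on_def)
  define K where "K = 1 / (c ^ l) powr s"

  have bound: "gale k \<beta> s G (seq_prefix R n) \<le> K" if n: "N0 * l \<le> n" for n
  proof -
    define N where "N = n div l"
    define u where "u = seq_prefix R (N * l)"
    define v where "v = map R [N * l..<n]"
    have uv: "seq_prefix R n = u @ v"
      unfolding u_def v_def seq_prefix_def N_def
      using upt_add_eq_append[of 0 "n div l * l" "n mod l"] by simp
    have setu: "set u \<subseteq> {..<k}" unfolding u_def by (rule set_seq_prefix[OF R(1)])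
    have setv: "set v \<subseteq> {..<k}" unfolding v_def by (rule set_map_seq[OF R(1)])
    have N: "N0 \<le> N" using n l(1) by (simp add: N_def less_eq_div_iff_mult_less_eq)
    have len: "length v \<le> l"
      using l(1) by (simp add: v_def N_def minus_div_mult_eq_mod less_imp_le)
    have "c ^ length v \<le> word_measure \<beta> v"
      using setv by (induction v)
        (auto simp: word_measure_prod_list c_le c0 bpos less_imp_le intro!: mult_mono)
    then have cv: "c ^ l \<le> word_measure \<beta> v"
      using power_decreasing[OF len, of c] c0 \<open>c \<le> 1\<close> by simp
    have st: "start G \<in> states G" using G by (simp add: FSG_def)
    have au: "0 < word_measure \<alpha> u" and bu: "0 < word_measure \<beta> u"
      using word_measure_pos[of k, OF _ setu] apos bpos by auto
    have "bet_weight G (start G) (u @ v) \<le> bet_weight G (start G) u"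
      unfolding bet_weight_append
      using bet_weight_bounds[OF G foldl_step_in_states[OF G st setu] setv]
        bet_weight_bounds[OF G st setu] by (simp add: mult_left_le)
    also have "\<dots> \<le> word_measure \<alpha> u * exp (Y N)"
      unfolding u_def Y_def using bet_weight_prefix_le[OF G R(1) apos] .
    finally have "gale k \<beta> s G (seq_prefix R n) \<le>
        word_measure \<alpha> u * exp (Y N) / word_measure \<beta> (u @ v) powr s"
      unfolding gale_eq_bet_weight[OF k] uv by (rule divide_right_mono) simp
    also have "\<dots> = word_measure \<alpha> u / word_measure \<beta> u powr s * exp (Y N) / word_measure \<beta> v powr s"
      using bu cv c0 by (simp add: word_measure_append powr_mult)
    also have "word_measure \<alpha> u / word_measure \<beta> u powr s = exp (X (N * l))"
      unfolding X_def using apos[OF Rk] bpos[OF Rk]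
      by (simp add: u_def word_measure_seq_prefix exp_sum exp_diff powr_def prod_dividef
          ln_prod less_imp_neq[symmetric] sum_distrib_left)
    \<comment> \<open>The exponent \<open>X (N * l) + Y N\<close> is nonpositive, so the numerator
      is at most \<open>1\<close>; \<open>0 \<le> s\<close> makes the power in the denominator
      monotone.\<close>
    also have "exp (X (N * l)) * exp (Y N) / word_measure \<beta> v powr s \<le> K"
      unfolding K_def using N0[OF N] cv c0 s
      by (intro frac_le powr_mono2) (auto simp flip: exp_add)
    finally show ?thesis .
  qed
  have "limsup (\<lambda>n. ereal (gale k \<beta> s G (seq_prefix R n))) \<le> ereal K"
    by (rule Limsup_bounded) (use bound in \<open>auto simp: eventually_sequentially\<close>)
  then show ?thesis by (rule le_less_trans) simp
qed

section \<open>The entropy ratio and the conclusion\<close>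

text \<open>Entropy plus divergence is the cross entropy of \<alpha> and \<beta>; the minus signs
  and the factors \<open>ln 2\<close> cancel in the quotient.\<close>

lemma entropy_ratio_eq:
  assumes "positive_prob_measure_on k \<alpha>" "positive_prob_measure_on k \<beta>"
  shows "shannon_entropy k \<alpha> / (shannon_entropy k \<alpha> + kl_divergence k \<alpha> \<beta>) =
    (\<Sum>a<k. \<alpha> a * ln (\<alpha> a)) / (\<Sum>a<k. \<alpha> a * ln (\<beta> a))"
proof -
  have pos: "0 < \<alpha> a" "0 < \<beta> a" if "a < k" for a
    using assms that by (auto simp: positive_prob_measure_on_def)
  have H: "shannon_entropy k \<alpha> = - (\<Sum>a<k. \<alpha> a * ln (\<alpha> a)) / ln 2"
    unfolding shannon_entropy_def sum_negf[symmetric] sum_divide_distrib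
    by (intro sum.cong) (auto simp: log_def ln_div dest: pos)
  have "shannon_entropy k \<alpha> + kl_divergence k \<alpha> \<beta> = - (\<Sum>a<k. \<alpha> a * ln (\<beta> a)) / ln 2"
    unfolding shannon_entropy_def kl_divergence_def sum.distrib[symmetric] sum_negf[symmetric]
      sum_divide_distrib
    by (intro sum.cong) (use pos in \<open>force simp: log_def ln_div field_simps\<close>)+
  with H show ?thesis by simp
qed

text \<open>With at least two letters of positive mass, every \<beta>-value is below
  \<open>1\<close>. Taking \<beta> equal to \<alpha> covers the numerator of the ratio as
  well.\<close>

lemma sum_mult_ln_measure_neg:
  assumes "2 \<le> k" "positive_prob_measure_on k \<alpha>" "positive_prob_measure_on k \<beta>"
  shows "(\<Sum>a<k. \<alpha> a * ln (\<beta> a)) < 0"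
proof -
  have pos: "0 < \<alpha> a" "0 < \<beta> a" if "a < k" for a
    using assms that by (auto simp: positive_prob_measure_on_def)
  have "\<beta> a < 1" if "a < k" for a
  proof -
    obtain b where b: "b < k" "b \<noteq> a"
      using assms(1) by (metis One_nat_def Suc_1 Suc_le_lessD less_trans zero_less_one zero_neq_one)
    then have "sum \<beta> {a, b} \<le> (\<Sum>a<k. \<beta> a)"
      using that pos by (intro sum_mono2) (auto intro: less_imp_le)
    then show ?thesis
      using b pos[of b] assms(3) by (auto simp: positive_prob_measure_on_def prob_measure_on_def)
  qed
  then have "0 < (\<Sum>a<k. - (\<alpha> a * ln (\<beta> a)))"
    using assms(1) pos by (intro sum_pos) (auto simp: mult_less_0_iff lessThan_empty_iff)
  then show ?thesis by (simp add: sum_negf)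
qed

theorem theorem5p4:
  fixes k :: nat and \<alpha> \<beta> :: "nat \<Rightarrow> real" and R :: "nat \<Rightarrow> nat"
  assumes "k \<ge> 2"
    and "positive_prob_measure_on k \<alpha>"
    and "positive_prob_measure_on k \<beta>"
    and "R \<in> sequences k"
    and "seq_normal k \<alpha> R"
  shows "dim_FS k \<beta> R = Dim_FS k \<beta> R \<and>
    Dim_FS k \<beta> R = ereal (shannon_entropy k \<alpha> / (shannon_entropy k \<alpha> + kl_divergence k \<alpha> \<beta>))"
proof -
  define A where "A = (\<Sum>a<k. \<alpha> a * ln (\<alpha> a))"
  define B where "B = (\<Sum>a<k. \<alpha> a * ln (\<beta> a))"
  have neg: "A < 0" "B < 0"
    unfolding A_def B_def using assms(1-3) by (auto intro: sum_mult_ln_measure_neg)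
  have k: "0 < k" using assms(1) by simp
  have "dim_FS k \<beta> R \<le> Dim_FS k \<beta> R"
    unfolding dim_FS_def Dim_FS_def
  proof (intro Inf_superset_mono image_mono Collect_mono impI, elim conjE exE)
    fix s and G :: "nat gambler"
    let ?g = "\<lambda>n. ereal (gale k \<beta> s G (seq_prefix R n))"
    assume "0 \<le> s" "FSG k G" "liminf ?g = \<infinity>"
    moreover have "liminf ?g \<le> limsup ?g" by (intro Liminf_le_Limsup) simp
    ultimately show "0 \<le> s \<and> (\<exists>G :: nat gambler. FSG k G \<and>
        limsup (\<lambda>n. ereal (gale k \<beta> s G (seq_prefix R n))) = \<infinity>)"
      by auto
  qed
  moreover have "ereal (A / B) \<le> dim_FS k \<beta> R"
    unfolding dim_FS_def
  proof (intro Inf_greatest, clarsimp)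
    fix s and G :: "nat gambler"
    assume *: "0 \<le> s" "FSG k G" "limsup (\<lambda>n. ereal (gale k \<beta> s G (seq_prefix R n))) = \<infinity>"
    \<comment> \<open>Since \<open>B < 0\<close>, the condition \<open>A - s * B < 0\<close> says
      exactly that \<open>s < A / B\<close>.\<close>
    have "\<not> A - s * B < 0"
      using limsup_gale_less_infinity[OF k assms(2-5) *(1) _ *(2)] *(3)
      unfolding A_def B_def by auto
    then show "A / B \<le> s" using neg by (simp add: neg_divide_le_eq)
  qed
  moreover have "Dim_FS k \<beta> R \<le> ereal (A / B)"
  proof (rule ereal_le_epsilon2)
    fix e :: real assume e: "0 < e"
    define s where "s = A / B + e"
    have s: "0 \<le> s" using neg e by (simp add: s_def divide_nonpos_neg)
    \<comment> \<open>For \<open>s = A / B + e\<close> the difference equals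
      \<open>- e * B\<close>.\<close>
    have "0 < A - s * B" using neg e by (simp add: s_def field_simps mult_less_0_iff)
    then obtain G :: "nat gambler" where "FSG k G"
      "liminf (\<lambda>n. ereal (gale k \<beta> s G (seq_prefix R n))) = \<infinity>"
      using liminf_gale_eq_infinity[OF k assms(2-5)] unfolding A_def B_def by blast
    with s have "Dim_FS k \<beta> R \<le> ereal s"
      unfolding Dim_FS_def by (intro Inf_lower) auto
    then show "Dim_FS k \<beta> R \<le> ereal (A / B) + ereal e" by (simp add: s_def)
  qed
  ultimately show ?thesis
    unfolding entropy_ratio_eq[OF assms(2,3)] A_def[symmetric] B_def[symmetric]
    by (metis order.antisym order.trans)
qed

end
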